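(* For every commutative ring $R$ with identity, the annihilating-ideal graph $\mathbb{AG}(R)$ is connected and $\mathrm{diam}(\mathbb{AG}(R))\leq 3$. Moreover, if $\mathbb{AG}(R)$ contains a cycle, then $\mathrm{gr}(\mathbb{AG}(R))\leq 4$.
   Context: An ideal $I$ of a commutative ring $R$ is called an annihilating-ideal if there exists a nonzero ideal $J$ of $R$ with $IJ=(0)$. $\mathbb{A}(R)$ denotes the set of all annihilating-ideals of $R$, and $\mathbb{A}(R)^*=\mathbb{A}(R)\setminus\{(0)\}$. The annihilating-ideal graph $\mathbb{AG}(R)$ is the undirected graph with vertex set $\mathbb{A}(R)^*$ in which two distinct vertices $I,J$ are adjacent if and only if $IJ=(0)$. A graph $G$ is connected if there is a path between every two distinct vertices (in particular a graph with no vertices counts as connected). For distinct vertices $x,y$, $d(x,y)$ is the length of a shortest path from $x$ to $y$ ($\infty$ if there is none), and $\mathrm{diam}(G)=\sup\{d(x,y) : x,y \text{ distinct vertices of } G\}$. The girth $\mathrm{gr}(G)$ is the length of a shortest cycle in $G$ ($\infty$ if $G$ has no cycles). *)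

theory Defs
  imports
    "HOL-Algebra.Ideal_Product"
    "HOL-Library.Extended_Nat"
    "Graph_Theory.Pair_Digraph"
begin

text \<open>
  An undirected simple graph is represented by a symmetric loop-free digraph given by a set of
  vertices and a set of ordered pairs. The vertex set may be infinite or empty; the
  predicate \<^verbatim>\<open>Digraph_Component.connected\<close> excludes the empty graph, hence the definition below.
\<close>

definition graph_connected :: "'v pair_pre_digraph \<Rightarrow> bool" where
  "graph_connected G \<longleftrightarrow>
     (\<forall>x \<in> pverts G. \<forall>y \<in> pverts G. x \<noteq> y \<longrightarrow> (\<exists>p. pre_digraph.apath (with_proj G) x p y))"

text \<open>In \<^typ>\<open>enat\<close> the infimum of the empty set is \<^term>\<open>\<infinity> :: enat\<close> and its supremum is 0.\<close>

definition graph_dist :: "'v pair_pre_digraph \<Rightarrow> 'v \<Rightarrow> 'v \<Rightarrow> enat" where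
  "graph_dist G x y = (INF p \<in> {p. pre_digraph.apath (with_proj G) x p y}. enat (length p))"

definition graph_diam :: "'v pair_pre_digraph \<Rightarrow> enat" where
  "graph_diam G = Sup {graph_dist G x y | x y. x \<in> pverts G \<and> y \<in> pverts G \<and> x \<noteq> y}"

text \<open>
  The library notion of a cycle counts going along an edge and back as a cycle of length 2;
  the cycles of an undirected simple graph are those of length at least 3.
\<close>

definition graph_cycle :: "'v pair_pre_digraph \<Rightarrow> ('v \<times> 'v) awalk \<Rightarrow> bool" where
  "graph_cycle G c \<longleftrightarrow> pre_digraph.cycle (with_proj G) c \<and> 3 \<le> length c"

definition graph_girth :: "'v pair_pre_digraph \<Rightarrow> enat" where
  "graph_girth G = (INF c \<in> {c. graph_cycle G c}. enat (length c))"

definition annihilating_ideal :: "('a, 'b) ring_scheme \<Rightarrow> 'a set \<Rightarrow> bool" where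
  "annihilating_ideal R I \<longleftrightarrow>
     ideal I R \<and> (\<exists>J. ideal J R \<and> J \<noteq> {\<zero>\<^bsub>R\<^esub>} \<and> I \<cdot>\<^bsub>R\<^esub> J = {\<zero>\<^bsub>R\<^esub>})"

definition annihilating_ideals :: "('a, 'b) ring_scheme \<Rightarrow> 'a set set" where
  "annihilating_ideals R = {I. annihilating_ideal R I}"

definition annihilating_ideal_graph :: "('a, 'b) ring_scheme \<Rightarrow> 'a set pair_pre_digraph" where
  "annihilating_ideal_graph R =
     \<lparr> pverts = annihilating_ideals R - {{\<zero>\<^bsub>R\<^esub>}},
       parcs = {(I, J). I \<in> annihilating_ideals R - {{\<zero>\<^bsub>R\<^esub>}} \<and>
                        J \<in> annihilating_ideals R - {{\<zero>\<^bsub>R\<^esub>}} \<and>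
                        I \<noteq> J \<and> I \<cdot>\<^bsub>R\<^esub> J = {\<zero>\<^bsub>R\<^esub>}} \<rparr>"

lemma annihilating_ideal_graph_bidirected:
  fixes R :: "('a, 'b) ring_scheme"
  assumes "cring R"
  shows "pair_bidirected_digraph (annihilating_ideal_graph R)"
proof -
  let ?G = "annihilating_ideal_graph R"
  have adj: "I \<in> pverts ?G" "J \<in> pverts ?G" "I \<noteq> J" "(J, I) \<in> parcs ?G"
    if "(I, J) \<in> parcs ?G" for I J
  proof -
    have *: "I \<in> annihilating_ideals R - {{\<zero>\<^bsub>R\<^esub>}}" "J \<in> annihilating_ideals R - {{\<zero>\<^bsub>R\<^esub>}}"
      "I \<noteq> J" "I \<cdot>\<^bsub>R\<^esub> J = {\<zero>\<^bsub>R\<^esub>}"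
      using that by (simp_all add: annihilating_ideal_graph_def)
    have "ideal I R" "ideal J R"
      using * by (simp_all add: annihilating_ideals_def annihilating_ideal_def)
    then have "J \<cdot>\<^bsub>R\<^esub> I = {\<zero>\<^bsub>R\<^esub>}"
      using cring.ideal_prod_commute[OF assms, of I J] *(4) by simp
    with * show "I \<in> pverts ?G" "J \<in> pverts ?G" "I \<noteq> J" "(J, I) \<in> parcs ?G"
      by (simp_all add: annihilating_ideal_graph_def)
  qed
  have 1: "pair_wf_digraph ?G"
  proof (rule pair_wf_digraph.intro)
    show "fst e \<in> pverts ?G" "snd e \<in> pverts ?G" if "e \<in> parcs ?G" for e
      using adj(1,2)[of "fst e" "snd e"] that by simp_all
  qed
  have 2: "symmetric (with_proj ?G)"
    unfolding symmetric_def with_proj_simps by (rule symI) (rule adj(4))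
  have 3: "fst e \<noteq> snd e" if "e \<in> parcs ?G" for e
    using adj(3)[of "fst e" "snd e"] that by simp
  show ?thesis
    by (intro pair_bidirected_digraph.intro pair_sym_digraph.intro pair_loopfree_digraph.intro
        pair_sym_digraph_axioms.intro pair_loopfree_digraph_axioms.intro 1 2 3)
qed

end

theory Submission
  imports Defs
begin

text \<open>
  Let \<open>I\<close>, \<open>J\<close> be vertices annihilated by the nonzero ideals \<open>I'\<close>, \<open>J'\<close>. If \<open>I' J' \<noteq> 0\<close>, then
  \<open>I - I' J' - J\<close> is a walk, and otherwise \<open>I - I' - J' - J\<close> is one; consecutive vertices may
  coincide here, which only shortens the path.

  A cycle of length at least 5 contains a path \<open>A - B - C - D - E\<close> on distinct vertices. Put
  \<open>K = A D\<close>, so \<open>K B = K C = 0\<close>. If \<open>K = 0\<close>, then \<open>A B C D\<close> is a 4-cycle. If \<open>K = B\<close>, then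
  \<open>B E = A D E = 0\<close> and \<open>B C D E\<close> is a 4-cycle. If \<open>K = C\<close>, then likewise \<open>C E = 0\<close> and
  \<open>C D E\<close> is a triangle. In the remaining case \<open>B C K\<close> is a triangle.
\<close>

text \<open>Permitting equality at each step spares the caller every distinction of coinciding
  vertices. The path is built backwards from \<open>y\<close>, each step adding at most one
  arc.\<close>

lemma (in pair_wf_digraph) apath_of_weak_walk:
  assumes "x \<in> pverts G" "x = a \<or> (x, a) \<in> parcs G" "a = b \<or> (a, b) \<in> parcs G"
    "b = y \<or> (b, y) \<in> parcs G"
  shows "\<exists>p. apath x p y \<and> length p \<le> 3"
proof -
  have arc: "\<exists>p. apath u p v \<and> length p \<le> 1" if "u \<in> pverts G" "u = v \<or> (u, v) \<in> parcs G" for u v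
  proof (cases "u = v")
    case True
    with that have "apath u [] v" by (simp add: apath_Nil_iff)
    then show ?thesis by (metis list.size(3) zero_le)
  next
    case False
    with that have "apath u [(u, v)] v" by (auto simp: apath_simps dest: in_arcsD2)
    then show ?thesis by (intro exI[of _ "[(u, v)]"]) simp
  qed
  \<comment> \<open>If \<open>u\<close> already lies on the path, the part of it from
    \<open>u\<close> onwards is a path that is no longer; otherwise the arc from \<open>u\<close> to
    \<open>v\<close> can be put in front.\<close>
  have step: "\<exists>p. apath u p w \<and> length p \<le> Suc n"
    if uv: "u = v \<or> (u, v) \<in> parcs G" and p: "apath v p w" "length p \<le> n" for u v w p n
  proof (cases "u \<in> set (pawalk_verts v p)")
    case True
    have "awalk v p w" using p by (simp add: apath_def)
    from awalk_decomp[OF this True] obtain q r where qr: "p = q @ r" "awalk v q u" "awalk u r w"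
      by metis
    \<comment> \<open>This identifies \<open>u\<close> as the vertex at which
      \<open>apath_append_iff\<close> splits the path.\<close>
    have "last (pawalk_verts v q) = u"
      using qr(2) by (auto elim: awalkE)
    with p(1) qr(1) have "apath u r w" by (simp add: apath_append_iff)
    with p(2) qr(1) show ?thesis by (intro exI[of _ r]) simp
  next
    case False
    \<comment> \<open>The start \<open>v\<close> lies on its own path, so \<open>u\<close> differs
      from \<open>v\<close> and the degenerate alternative drops out.\<close>
    have "v \<in> set (pawalk_verts v p)"
      using p(1) by (cases p) (auto simp: apath_def awalk_def)
    with False uv have "(u, v) \<in> parcs G" by auto
    with False p have "apath u ((u, v) # p) w" by (simp add: apath_Cons_iff)
    with p(2) show ?thesis by (intro exI[of _ "(u, v) # p"]) simp
  qed
  have "b \<in> pverts G" using assms by (auto dest: in_arcsD2)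
  from arc[OF this assms(4)] obtain p where "apath b p y" "length p \<le> 1" by blast
  from step[OF assms(3) this] obtain q where "apath a q y" "length q \<le> Suc 1" by blast
  from step[OF assms(2) this] show ?thesis by (simp add: numeral_3_eq_3)
qed

lemma graph_girth_le:
  assumes "graph_cycle G c" "length c \<le> n"
  shows "graph_girth G \<le> enat n"
  unfolding graph_girth_def using assms by (intro INF_lower2[of c]) auto

lemma (in pair_wf_digraph) girth_le_triangle:
  assumes "(a, b) \<in> parcs G" "(b, c) \<in> parcs G" "(c, a) \<in> parcs G" "distinct [a, b, c]"
  shows "graph_girth G \<le> 4"
proof -
  have "cycle [(a, b), (b, c), (c, a)]"
    using assms by (auto simp: cycle_def awalk_simps dest: in_arcsD1)
  then show ?thesis
    using graph_girth_le[of G "[(a, b), (b, c), (c, a)]" 4]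
    by (simp add: graph_cycle_def numeral_eq_enat)
qed

lemma (in pair_wf_digraph) girth_le_square:
  assumes "(a, b) \<in> parcs G" "(b, c) \<in> parcs G" "(c, d) \<in> parcs G" "(d, a) \<in> parcs G"
    "distinct [a, b, c, d]"
  shows "graph_girth G \<le> 4"
proof -
  have "cycle [(a, b), (b, c), (c, d), (d, a)]"
    using assms by (auto simp: cycle_def awalk_simps dest: in_arcsD1)
  then show ?thesis
    using graph_girth_le[of G "[(a, b), (b, c), (c, d), (d, a)]" 4]
    by (simp add: graph_cycle_def numeral_eq_enat)
qed

text \<open>A cycle repeats only its start, so the tail of its vertex list is distinct. The path
  therefore begins at the source of the second arc and uses arcs two to five; for length exactly 5
  it ends at the start of the cycle.\<close>

lemma (in pair_wf_digraph) long_cycle_contains_path: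
  assumes "graph_cycle G p" "5 \<le> length p"
  obtains a b c d e where "(a, b) \<in> parcs G" "(b, c) \<in> parcs G" "(c, d) \<in> parcs G"
    "(d, e) \<in> parcs G" "distinct [a, b, c, d, e]"
proof -
  obtain f1 f2 f3 f4 f5 q where p: "p = f1 # f2 # f3 # f4 # f5 # q"
    using assms(2) by (auto simp: numeral_eq_Suc Suc_le_length_iff)
  obtain u where u: "awalk u p u" "distinct (tl (pawalk_verts u p))"
    using assms(1) by (auto simp: graph_cycle_def cycle_def)
  \<comment> \<open>If \<open>q\<close> is nonempty, its vertex list begins with the source of its
    first arc, which equals \<open>snd f5\<close> because \<open>p\<close> is a walk.\<close>
  have "snd f5 \<in> set (pawalk_verts (snd f5) q)"
    using u(1) unfolding p by (cases q) (auto simp: awalk_simps)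
  with u have "distinct [fst f2, fst f3, fst f4, fst f5, snd f5]"
    unfolding p by auto
  moreover have "(fst f2, fst f3) \<in> parcs G" "(fst f3, fst f4) \<in> parcs G"
    "(fst f4, fst f5) \<in> parcs G" "(fst f5, snd f5) \<in> parcs G"
    using u(1) unfolding p by (auto simp: awalk_Cons_iff) (metis prod.collapse)+
  ultimately show thesis using that by blast
qed

context cring
begin

lemma pverts_annihilating_ideal_graph_iff:
  "I \<in> pverts (annihilating_ideal_graph R) \<longleftrightarrow>
     ideal I R \<and> I \<noteq> {\<zero>} \<and> (\<exists>J. ideal J R \<and> J \<noteq> {\<zero>} \<and> I \<cdot> J = {\<zero>})"
  by (auto simp: annihilating_ideal_graph_def annihilating_ideals_def annihilating_ideal_def)

text \<open>Each of \<open>I\<close> and \<open>J\<close> is the nonzero witness that makes the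
  other an annihilating-ideal.\<close>

lemma parcs_annihilating_ideal_graph_iff:
  "(I, J) \<in> parcs (annihilating_ideal_graph R) \<longleftrightarrow>
     ideal I R \<and> ideal J R \<and> I \<noteq> {\<zero>} \<and> J \<noteq> {\<zero>} \<and> I \<noteq> J \<and> I \<cdot> J = {\<zero>}"
  using ideal_prod_commute[of I J]
  by (auto simp: annihilating_ideal_graph_def annihilating_ideals_def annihilating_ideal_def)

text \<open>Commutativity and associativity bring the annihilated factor next to \<open>K\<close>.
  Thus a product of ideals inherits the annihilators of both factors.\<close>

lemma ideal_prod_annihilated:
  assumes "ideal I R" "ideal J R" "ideal K R" "I \<cdot> K = {\<zero>} \<or> J \<cdot> K = {\<zero>}"
  shows "(I \<cdot> J) \<cdot> K = {\<zero>}"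
  using assms(4)
proof
  assume "I \<cdot> K = {\<zero>}"
  then show ?thesis
    using assms ideal_prod_assoc[of J I K] ideal_prod_commute[of I J] ideal_prod_zero[of J] by simp
next
  assume "J \<cdot> K = {\<zero>}"
  then show ?thesis
    using assms ideal_prod_assoc[of I J K] ideal_prod_zero[of I] by simp
qed

text \<open>This yields connectedness and the diameter bound at once.\<close>

lemma annihilating_ideal_graph_short_path:
  assumes "I \<in> pverts (annihilating_ideal_graph R)" "J \<in> pverts (annihilating_ideal_graph R)"
  shows "\<exists>p. pre_digraph.apath (with_proj (annihilating_ideal_graph R)) I p J \<and> length p \<le> 3"
proof -
  interpret G: pair_bidirected_digraph "annihilating_ideal_graph R"
    by (rule annihilating_ideal_graph_bidirected[OF is_cring])
  obtain I' where I: "ideal I R" "I \<noteq> {\<zero>}" "ideal I' R" "I' \<noteq> {\<zero>}" "I \<cdot> I' = {\<zero>}"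
    using assms(1) by (auto simp: pverts_annihilating_ideal_graph_iff)
  obtain J' where J: "ideal J R" "J \<noteq> {\<zero>}" "ideal J' R" "J' \<noteq> {\<zero>}" "J \<cdot> J' = {\<zero>}"
    using assms(2) by (auto simp: pverts_annihilating_ideal_graph_iff)
  have comm: "I' \<cdot> I = {\<zero>}" "J' \<cdot> J = {\<zero>}"
    using I J ideal_prod_commute by metis+
  show ?thesis
  proof (cases "I' \<cdot> J' = {\<zero>}")
    case True
    show ?thesis
      by (rule G.apath_of_weak_walk[of I I' J' J])
        (use assms I J comm True in \<open>auto simp: parcs_annihilating_ideal_graph_iff\<close>)
  next
    case False
    let ?K = "I' \<cdot> J'"
    have K: "ideal ?K R" using I J by (simp add: ideal_prod_is_ideal)
    have "?K \<cdot> I = {\<zero>}" "?K \<cdot> J = {\<zero>}"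
      using I J comm by (simp_all add: ideal_prod_annihilated)
    then have "I \<cdot> ?K = {\<zero>}" "?K \<cdot> J = {\<zero>}"
      using ideal_prod_commute[OF K I(1)] by simp_all
    then show ?thesis
      \<comment> \<open>The walk through \<open>?K\<close> has two steps; repeating
        \<open>?K\<close> pads it to three.\<close>
      by (intro G.apath_of_weak_walk[of I ?K ?K J])
        (use assms I J K False in \<open>auto simp: parcs_annihilating_ideal_graph_iff\<close>)
  qed
qed

lemma annihilating_ideal_graph_girth:
  assumes "graph_cycle (annihilating_ideal_graph R) p"
  shows "graph_girth (annihilating_ideal_graph R) \<le> 4"
proof (cases "length p \<le> 4")
  case True
  with graph_girth_le[OF assms, of 4] show ?thesis by (simp add: numeral_eq_enat)
next
  case False
  interpret G: pair_bidirected_digraph "annihilating_ideal_graph R"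
    by (rule annihilating_ideal_graph_bidirected[OF is_cring])
  note arc = parcs_annihilating_ideal_graph_iff
  from False have "5 \<le> length p" by simp
  with assms obtain A B C D E where path: "(A, B) \<in> parcs (annihilating_ideal_graph R)"
      "(B, C) \<in> parcs (annihilating_ideal_graph R)" "(C, D) \<in> parcs (annihilating_ideal_graph R)"
      "(D, E) \<in> parcs (annihilating_ideal_graph R)"
    and dist: "distinct [A, B, C, D, E]"
    by (rule G.long_cycle_contains_path)
  let ?K = "A \<cdot> D"
  have ideals: "ideal A R" "ideal B R" "ideal C R" "ideal D R" "ideal E R"
    and nonzero: "A \<noteq> {\<zero>}" "B \<noteq> {\<zero>}" "C \<noteq> {\<zero>}" "D \<noteq> {\<zero>}" "E \<noteq> {\<zero>}"
    and prods: "A \<cdot> B = {\<zero>}" "B \<cdot> C = {\<zero>}" "C \<cdot> D = {\<zero>}" "D \<cdot> E = {\<zero>}"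
    using path by (simp_all add: arc)
  have K: "ideal ?K R" using ideals by (simp add: ideal_prod_is_ideal)
  have "D \<cdot> C = {\<zero>}" using prods(3) ideal_prod_commute[OF ideals(3,4)] by simp
  \<comment> \<open>The factor \<open>A\<close> kills \<open>B\<close>, while \<open>D\<close> kills
    both \<open>C\<close> and \<open>E\<close>.\<close>
  then have KB: "?K \<cdot> B = {\<zero>}" and KC: "?K \<cdot> C = {\<zero>}" and KE: "?K \<cdot> E = {\<zero>}"
    using ideals prods by (simp_all add: ideal_prod_annihilated)
  consider "?K = {\<zero>}" | "?K = B" | "?K = C" | "?K \<noteq> {\<zero>}" "?K \<noteq> B" "?K \<noteq> C" by blast
  then show ?thesis
  proof cases
    case 1
    then have "D \<cdot> A = {\<zero>}" using ideal_prod_commute[OF ideals(1,4)] by simp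
    with ideals nonzero dist have "(D, A) \<in> parcs (annihilating_ideal_graph R)"
      by (auto simp: arc)
    from G.girth_le_square[OF path(1-3) this] dist show ?thesis by simp
  next
    case 2
    with KE have "E \<cdot> B = {\<zero>}" using ideal_prod_commute[OF ideals(2,5)] by simp
    with ideals nonzero dist have "(E, B) \<in> parcs (annihilating_ideal_graph R)"
      by (auto simp: arc)
    from G.girth_le_square[OF path(2-4) this] dist show ?thesis by simp
  next
    case 3
    with KE have "E \<cdot> C = {\<zero>}" using ideal_prod_commute[OF ideals(3,5)] by simp
    with ideals nonzero dist have "(E, C) \<in> parcs (annihilating_ideal_graph R)"
      by (auto simp: arc)
    from G.girth_le_triangle[OF path(3,4) this] dist show ?thesis by simp
  next
    case 4
    have "C \<cdot> ?K = {\<zero>}" using KC ideal_prod_commute[OF K ideals(3)] by simp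
    with 4 KB K ideals nonzero
    have "(C, ?K) \<in> parcs (annihilating_ideal_graph R)"
      "(?K, B) \<in> parcs (annihilating_ideal_graph R)"
      by (auto simp: arc)
    from G.girth_le_triangle[OF path(2) this] dist 4 show ?thesis by auto
  qed
qed

end

theorem theorem2p1:
  fixes R :: "('a, 'b) ring_scheme"
  assumes "cring R"
  shows "graph_connected (annihilating_ideal_graph R) \<and>
         graph_diam (annihilating_ideal_graph R) \<le> 3 \<and>
         ((\<exists>c. graph_cycle (annihilating_ideal_graph R) c) \<longrightarrow>
            graph_girth (annihilating_ideal_graph R) \<le> 4)"
proof (intro conjI impI)
  interpret cring R by fact
  show "graph_connected (annihilating_ideal_graph R)"
    unfolding graph_connected_def using annihilating_ideal_graph_short_path by blast
  have "graph_dist (annihilating_ideal_graph R) I J \<le> 3"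
    if vertices: "I \<in> pverts (annihilating_ideal_graph R)" "J \<in> pverts (annihilating_ideal_graph R)"
    for I J
  proof -
    obtain p where "pre_digraph.apath (with_proj (annihilating_ideal_graph R)) I p J" "length p \<le> 3"
      using annihilating_ideal_graph_short_path[OF vertices] by blast
    then show ?thesis
      unfolding graph_dist_def by (intro INF_lower2[of p]) (auto simp: numeral_eq_enat)
  qed
  \<comment> \<open>With fewer than two vertices the supremum is over the empty set, and
    \<open>Sup_least\<close> covers this case as well.\<close>
  then show "graph_diam (annihilating_ideal_graph R) \<le> 3"
    unfolding graph_diam_def by (intro Sup_least) auto
  show "graph_girth (annihilating_ideal_graph R) \<le> 4"
    if "\<exists>c. graph_cycle (annihilating_ideal_graph R) c"
    using that annihilating_ideal_graph_girth by blast
qed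

end
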